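(* Let $\varepsilon_\pm\in\mathbb C$, $g_0=\rho/(q-q^{-1})$ and $g_{k+1}\in\mathbb C$ for $k\in\mathbb N$, and let $\epsilon:\mathcal A_q\to\mathbb C$ be the corresponding one-dimensional representation. Then $$(\epsilon\otimes\mathrm{id})\big(\mathcal K^{(\frac12)}(u)\big)=\varsigma^{(\frac12)}(u)\,K^{(\frac12)}(u),$$ with $$K^{(\frac12)}(u)=\begin{pmatrix}u\varepsilon_++u^{-1}\varepsilon_-&k_+(u^2-u^{-2})/(q-q^{-1})\\ k_-(u^2-u^{-2})/(q-q^{-1})&u\varepsilon_-+u^{-1}\varepsilon_+\end{pmatrix}$$ and with the invertible formal series $$\varsigma^{(\frac12)}(u)=\frac{c(q^2)}{\rho\,c(u^2)}\Big(\sum_{k=0}^\infty U^{-k}g_k\Big).$$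
   Context: $q\in\mathbb C^*$ is not a root of unity, $\mathbb N=\{0,1,\dots\}$, $\overline m=m\bmod2\in\{0,1\}$, $[X,Y]_q=qXY-q^{-1}YX$, $c(u)=u-u^{-1}$; rational functions of $u$ are expanded in $u^{-1}$ and "invertible" means invertible in $\mathbb C((u^{-1}))$. Fix $k_\pm\in\mathbb C^*$, $\rho=k_+k_-(q+q^{-1})^2$. $\mathcal A_q$ is the unital associative $\mathbb C$-algebra generated by $\mathsf W_{-k},\mathsf W_{k+1},\mathsf G_{k+1},\tilde{\mathsf G}_{k+1}$ ($k\in\mathbb N$) with, for all $k,l\in\mathbb N$: $[\mathsf W_0,\mathsf W_{k+1}]=[\mathsf W_{-k},\mathsf W_1]=\frac{\tilde{\mathsf G}_{k+1}-\mathsf G_{k+1}}{q+q^{-1}}$; $[\mathsf W_0,\mathsf G_{k+1}]_q=[\tilde{\mathsf G}_{k+1},\mathsf W_0]_q=\rho(\mathsf W_{-k-1}-\mathsf W_{k+1})$; $[\mathsf G_{k+1},\mathsf W_1]_q=[\mathsf W_1,\tilde{\mathsf G}_{k+1}]_q=\rho(\mathsf W_{k+2}-\mathsf W_{-k})$; $[\mathsf W_{-k},\mathsf W_{-l}]=[\mathsf W_{k+1},\mathsf W_{l+1}]=[\mathsf G_{k+1},\mathsf G_{l+1}]=[\tilde{\mathsf G}_{k+1},\tilde{\mathsf G}_{l+1}]=0$; $[\mathsf W_{-k},\mathsf W_{l+1}]+[\mathsf W_{k+1},\mathsf W_{-l}]=0$; $[\mathsf W_{-k},\mathsf G_{l+1}]+[\mathsf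 G_{k+1},\mathsf W_{-l}]=0$; $[\mathsf W_{-k},\tilde{\mathsf G}_{l+1}]+[\tilde{\mathsf G}_{k+1},\mathsf W_{-l}]=0$; $[\mathsf W_{k+1},\mathsf G_{l+1}]+[\mathsf G_{k+1},\mathsf W_{l+1}]=0$; $[\mathsf W_{k+1},\tilde{\mathsf G}_{l+1}]+[\tilde{\mathsf G}_{k+1},\mathsf W_{l+1}]=0$; $[\tilde{\mathsf G}_{k+1},\mathsf G_{l+1}]+[\mathsf G_{k+1},\tilde{\mathsf G}_{l+1}]=0$. Put $U=\frac{qu^2+q^{-1}u^{-2}}{q+q^{-1}}$, $\mathsf W_+(u)=\sum_{k\ge0}\mathsf W_{-k}U^{-k-1}$, $\mathsf W_-(u)=\sum_{k\ge0}\mathsf W_{k+1}U^{-k-1}$, $\mathsf G_+(u)=\sum_{k\ge0}\mathsf G_{k+1}U^{-k-1}$, $\mathsf G_-(u)=\sum_{k\ge0}\tilde{\mathsf G}_{k+1}U^{-k-1}$ and $$\mathcal K^{(\frac12)}(u)=\begin{pmatrix}uq\mathsf W_+(u)-u^{-1}q^{-1}\mathsf W_-(u)&\frac{\mathsf G_+(u)}{k_-(q+q^{-1})}+\frac{k_+(q+q^{-1})}{q-q^{-1}}\\ \frac{\mathsf G_-(u)}{k_+(q+q^{-1})}+\frac{k_-(q+q^{-1})}{q-q^{-1}}&uq\mathsf W_-(u)-u^{-1}q^{-1}\mathsf W_+(u)\end{pmatrix}.$$ The one-dimensional representation $\epsilon$ is the algebra map with $\epsilon(\mathsf G_{k+1})=\epsilon(\tilde{\mathsf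 G}_{k+1})=g_{k+1}$, $\epsilon(\mathsf W_{k+1})=g_0^{-1}\sum_{m=0}^k(\overline m\varepsilon_++\overline{m+1}\varepsilon_-)g_{k-m}$, $\epsilon(\mathsf W_{-k})=\epsilon(\mathsf W_{k+1})|_{\varepsilon_\pm\to\varepsilon_\mp}$, $k\in\mathbb N$. *)

theory Defs
  imports
    "HOL-Analysis.Finite_Cartesian_Product"
    "HOL-Computational_Algebra.Formal_Laurent_Series"
    "HOL-Library.Poly_Mapping"
    "HOL-Algebra.Module"
    "HOL-Algebra.QuotRing"
    "HOL-Algebra.Algebraic_Closure_Type"
begin

section \<open>Free associative algebras\<close>

text \<open>
  The free monoid on \<open>'g\<close> is wrapped in a type of its own so that it can be an instance of
  \<^class>\<open>monoid_add\<close>; the library's convolution product on finitely supported functions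
  then makes \<open>'g word \<Rightarrow>\<^sub>0 complex\<close> the free unital associative complex algebra on \<open>'g\<close>.
\<close>

datatype 'g word = Word (letters: "'g list")

instantiation word :: (type) monoid_add
begin
definition zero_word :: "'g word" where "zero_word = Word []"
definition plus_word :: "'g word \<Rightarrow> 'g word \<Rightarrow> 'g word"
  where "plus_word v w = Word (letters v @ letters w)"
instance by standard (simp_all add: zero_word_def plus_word_def)
end

type_synonym 'g free_algebra = "'g word \<Rightarrow>\<^sub>0 complex"

definition fgen :: "'g \<Rightarrow> 'g free_algebra"
  where "fgen x = Poly_Mapping.single (Word [x]) 1"

definition fconst :: "complex \<Rightarrow> 'g free_algebra"
  where "fconst c = Poly_Mapping.single 0 c"

definition comm :: "'g free_algebra \<Rightarrow> 'g free_algebra \<Rightarrow> 'g free_algebra"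
  where "comm x y = x * y - y * x"

definition qcomm :: "complex \<Rightarrow> 'g free_algebra \<Rightarrow> 'g free_algebra \<Rightarrow> 'g free_algebra"
  where "qcomm q x y = fconst q * x * y - fconst (inverse q) * y * x"

section \<open>The algebra \<open>A\<^sub>q\<close>\<close>

text \<open>
  \<open>gWn k\<close>, \<open>gWp k\<close>, \<open>gG k\<close>, \<open>gGt k\<close> stand for \<open>W\<^bsub>-k\<^esub>\<close>, \<open>W\<^bsub>k+1\<^esub>\<close>, \<open>G\<^bsub>k+1\<^esub>\<close> and \<open>G\<^bsub>k+1\<^esub>\<close> with a tilde.
\<close>

datatype Aq_gen = gWn nat | gWp nat | gG nat | gGt nat

abbreviation (input) xWn :: "nat \<Rightarrow> Aq_gen free_algebra" where "xWn k \<equiv> fgen (gWn k)"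
abbreviation (input) xWp :: "nat \<Rightarrow> Aq_gen free_algebra" where "xWp k \<equiv> fgen (gWp k)"
abbreviation (input) xG :: "nat \<Rightarrow> Aq_gen free_algebra" where "xG k \<equiv> fgen (gG k)"
abbreviation (input) xGt :: "nat \<Rightarrow> Aq_gen free_algebra" where "xGt k \<equiv> fgen (gGt k)"

definition rho :: "complex \<Rightarrow> complex \<Rightarrow> complex \<Rightarrow> complex"
  where "rho q kp km = kp * km * (q + inverse q)\<^sup>2"

text \<open>\<open>Aq_rel q kp km a b\<close>: the defining relations \<open>a = b\<close>, before passing to the quotient.\<close>

inductive Aq_rel ::
    "complex \<Rightarrow> complex \<Rightarrow> complex \<Rightarrow> Aq_gen free_algebra \<Rightarrow> Aq_gen free_algebra \<Rightarrow> bool"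
  for q kp km :: complex where
  "Aq_rel q kp km (comm (xWn 0) (xWp k)) (fconst (1 / (q + inverse q)) * (xGt k - xG k))"
| "Aq_rel q kp km (comm (xWn k) (xWp 0)) (fconst (1 / (q + inverse q)) * (xGt k - xG k))"
| "Aq_rel q kp km (qcomm q (xWn 0) (xG k)) (fconst (rho q kp km) * (xWn (k + 1) - xWp k))"
| "Aq_rel q kp km (qcomm q (xGt k) (xWn 0)) (fconst (rho q kp km) * (xWn (k + 1) - xWp k))"
| "Aq_rel q kp km (qcomm q (xG k) (xWp 0)) (fconst (rho q kp km) * (xWp (k + 1) - xWn k))"
| "Aq_rel q kp km (qcomm q (xWp 0) (xGt k)) (fconst (rho q kp km) * (xWp (k + 1) - xWn k))"
| "Aq_rel q kp km (comm (xWn k) (xWn l)) 0"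
| "Aq_rel q kp km (comm (xWp k) (xWp l)) 0"
| "Aq_rel q kp km (comm (xG k) (xG l)) 0"
| "Aq_rel q kp km (comm (xGt k) (xGt l)) 0"
| "Aq_rel q kp km (comm (xWn k) (xWp l) + comm (xWp k) (xWn l)) 0"
| "Aq_rel q kp km (comm (xWn k) (xG l) + comm (xG k) (xWn l)) 0"
| "Aq_rel q kp km (comm (xWn k) (xGt l) + comm (xGt k) (xWn l)) 0"
| "Aq_rel q kp km (comm (xWp k) (xG l) + comm (xG k) (xWp l)) 0"
| "Aq_rel q kp km (comm (xWp k) (xGt l) + comm (xGt k) (xWp l)) 0"
| "Aq_rel q kp km (comm (xGt k) (xG l) + comm (xG k) (xGt l)) 0"

definition Aq_ideal :: "complex \<Rightarrow> complex \<Rightarrow> complex \<Rightarrow> Aq_gen free_algebra set"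
  where "Aq_ideal q kp km =
    genideal ring_of_type_algebra {a - b | a b. Aq_rel q kp km a b}"

definition Aq_class :: "complex \<Rightarrow> complex \<Rightarrow> complex \<Rightarrow> Aq_gen free_algebra \<Rightarrow> Aq_gen free_algebra set"
  where "Aq_class q kp km x = Aq_ideal q kp km +>\<^bsub>ring_of_type_algebra\<^esub> x"

text \<open>
  The quotient ring, extended by its scalar multiplication. The library's locale for algebras
  covers commutative algebras only; here only its record type is used.
\<close>

definition Aq :: "complex \<Rightarrow> complex \<Rightarrow> complex \<Rightarrow> (complex, Aq_gen free_algebra set) module"
  where "Aq q kp km =
    (let Q = (ring_of_type_algebra :: Aq_gen free_algebra ring) Quot Aq_ideal q kp km
     in ring.extend Q (module.fields (\<lambda>c x. Aq_class q kp km (fconst c) \<otimes>\<^bsub>Q\<^esub> x)))"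

section \<open>Formal Laurent series in the inverse of \<open>u\<close>\<close>

text \<open>
  The variable \<^term>\<open>fls_X\<close> of the library is \<open>u\<^sup>-\<^sup>1\<close>, so that \<^typ>\<open>complex fls\<close> is
  \<open>\<complex>((u\<^sup>-\<^sup>1))\<close>, a field, and its division is the expansion in \<open>u\<^sup>-\<^sup>1\<close>.
\<close>

abbreviation uu :: "complex fls" where "uu \<equiv> fls_X_inv"

definition cfun :: "'a::field \<Rightarrow> 'a"
  where "cfun x = x - inverse x"

definition UU :: "complex \<Rightarrow> complex fls"
  where "UU q = (fls_const q * uu\<^sup>2 + fls_const (inverse q) * (inverse uu)\<^sup>2) / fls_const (q + inverse q)"

text \<open>
  Series in \<open>u\<^sup>-\<^sup>1\<close> with coefficients in the carrier of \<open>A\<close> are coefficient functions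
  \<open>int \<Rightarrow> 'r\<close>; as in \<^typ>\<open>complex fls\<close>, the value at \<open>n\<close> is the coefficient of \<open>u\<^sup>-\<^sup>n\<close>.
  In \<open>ser_const\<close>, \<open>ser_smult\<close> and \<open>ser_sum\<close> complex Laurent series act as coefficients:
  these are \<open>f \<cdot> 1\<close>, \<open>f \<cdot> s\<close> and \<open>\<Sum>\<^sub>k f\<^sub>k \<cdot> a\<^sub>k\<close>. The index sets select the nonzero terms, which are
  finitely many at each \<open>n\<close> if \<open>s\<close> is a Laurent series and the order of \<open>f\<^sub>k\<close> tends to infinity.
\<close>

definition ser_const :: "(complex, 'r) module \<Rightarrow> complex fls \<Rightarrow> int \<Rightarrow> 'r"
  where "ser_const A f n = fls_nth f n \<odot>\<^bsub>A\<^esub> \<one>\<^bsub>A\<^esub>"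

definition ser_add :: "(complex, 'r) module \<Rightarrow> (int \<Rightarrow> 'r) \<Rightarrow> (int \<Rightarrow> 'r) \<Rightarrow> int \<Rightarrow> 'r"
  where "ser_add A s t n = s n \<oplus>\<^bsub>A\<^esub> t n"

definition ser_diff :: "(complex, 'r) module \<Rightarrow> (int \<Rightarrow> 'r) \<Rightarrow> (int \<Rightarrow> 'r) \<Rightarrow> int \<Rightarrow> 'r"
  where "ser_diff A s t n = s n \<ominus>\<^bsub>A\<^esub> t n"

definition ser_smult :: "(complex, 'r) module \<Rightarrow> complex fls \<Rightarrow> (int \<Rightarrow> 'r) \<Rightarrow> int \<Rightarrow> 'r"
  where "ser_smult A f s n =
    (\<Oplus>\<^bsub>A\<^esub>i\<in>{i. fls_nth f i \<noteq> 0 \<and> s (n - i) \<noteq> \<zero>\<^bsub>A\<^esub>}. fls_nth f i \<odot>\<^bsub>A\<^esub> s (n - i))"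

definition ser_sum :: "(complex, 'r) module \<Rightarrow> (nat \<Rightarrow> complex fls) \<Rightarrow> (nat \<Rightarrow> 'r) \<Rightarrow> int \<Rightarrow> 'r"
  where "ser_sum A f a n =
    (\<Oplus>\<^bsub>A\<^esub>k\<in>{k. fls_nth (f k) n \<noteq> 0}. fls_nth (f k) n \<odot>\<^bsub>A\<^esub> a k)"

section \<open>The matrices\<close>

definition mat2 :: "'a \<Rightarrow> 'a \<Rightarrow> 'a \<Rightarrow> 'a \<Rightarrow> 'a^2^2"
  where "mat2 a b c d =
    (\<chi> i j. if i = 1 then (if j = 1 then a else b) else (if j = 1 then c else d))"

definition gen_series ::
    "complex \<Rightarrow> complex \<Rightarrow> complex \<Rightarrow> (nat \<Rightarrow> Aq_gen) \<Rightarrow> int \<Rightarrow> Aq_gen free_algebra set"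
  where "gen_series q kp km x =
    ser_sum (Aq q kp km) (\<lambda>k. inverse (UU q) ^ (k + 1)) (\<lambda>k. Aq_class q kp km (fgen (x k)))"

definition calK :: "complex \<Rightarrow> complex \<Rightarrow> complex \<Rightarrow> (int \<Rightarrow> Aq_gen free_algebra set)^2^2"
  where "calK q kp km =
    (let A = Aq q kp km;
         Wplus = gen_series q kp km gWn;
         Wminus = gen_series q kp km gWp;
         Gplus = gen_series q kp km gG;
         Gminus = gen_series q kp km gGt
     in mat2
       (ser_diff A (ser_smult A (uu * fls_const q) Wplus)
                   (ser_smult A (inverse uu * fls_const (inverse q)) Wminus))
       (ser_add A (ser_smult A (fls_const (1 / (km * (q + inverse q)))) Gplus)
                  (ser_const A (fls_const (kp * (q + inverse q) / (q - inverse q)))))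
       (ser_add A (ser_smult A (fls_const (1 / (kp * (q + inverse q)))) Gminus)
                  (ser_const A (fls_const (km * (q + inverse q) / (q - inverse q)))))
       (ser_diff A (ser_smult A (uu * fls_const q) Wminus)
                   (ser_smult A (inverse uu * fls_const (inverse q)) Wplus)))"

definition Kmat :: "complex \<Rightarrow> complex \<Rightarrow> complex \<Rightarrow> complex \<Rightarrow> complex \<Rightarrow> complex fls^2^2"
  where "Kmat q kp km ep em = mat2
    (uu * fls_const ep + inverse uu * fls_const em)
    (fls_const kp * (uu\<^sup>2 - (inverse uu)\<^sup>2) / fls_const (q - inverse q))
    (fls_const km * (uu\<^sup>2 - (inverse uu)\<^sup>2) / fls_const (q - inverse q))
    (uu * fls_const em + inverse uu * fls_const ep)"

text \<open>The infinite sum converges in the library's topology on \<^typ>\<open>complex fls\<close>, the adic one.\<close>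

definition varsig :: "complex \<Rightarrow> complex \<Rightarrow> complex \<Rightarrow> (nat \<Rightarrow> complex) \<Rightarrow> complex fls"
  where "varsig q kp km g =
    fls_const (cfun (q\<^sup>2)) / (fls_const (rho q kp km) * cfun (uu\<^sup>2)) *
    suminf (\<lambda>k. inverse (UU q) ^ k * fls_const (g k))"

section \<open>The one-dimensional representation\<close>

definition eps_W :: "(nat \<Rightarrow> complex) \<Rightarrow> complex \<Rightarrow> complex \<Rightarrow> nat \<Rightarrow> complex"
  where "eps_W g ep em k =
    inverse (g 0) * (\<Sum>m=0..k. (of_nat (m mod 2) * ep + of_nat ((m + 1) mod 2) * em) * g (k - m))"

definition is_eps ::
    "complex \<Rightarrow> complex \<Rightarrow> complex \<Rightarrow> complex \<Rightarrow> complex \<Rightarrow> (nat \<Rightarrow> complex)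
      \<Rightarrow> (Aq_gen free_algebra set \<Rightarrow> complex) \<Rightarrow> bool"
  where "is_eps q kp km ep em g eps \<longleftrightarrow>
    eps \<in> ring_hom (Aq q kp km) ring_of_type_algebra \<and>
    (\<forall>c. \<forall>x\<in>carrier (Aq q kp km). eps (c \<odot>\<^bsub>Aq q kp km\<^esub> x) = c * eps x) \<and>
    (\<forall>k. eps (Aq_class q kp km (fgen (gG k))) = g (k + 1)) \<and>
    (\<forall>k. eps (Aq_class q kp km (fgen (gGt k))) = g (k + 1)) \<and>
    (\<forall>k. eps (Aq_class q kp km (fgen (gWp k))) = eps_W g ep em k) \<and>
    (\<forall>k. eps (Aq_class q kp km (fgen (gWn k))) = eps_W g em ep k)"

text \<open>The remainder shows that \<open>A\<^sub>q\<close> is a quotient by a two-sided ideal and that such a representation exists.\<close>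

lemma ring_of_type_algebra_ring: "ring (ring_of_type_algebra :: 'a::ring_1 ring)"
proof -
  have "\<exists>y. x + y = 0" for x :: 'a
    using add.right_inverse by blast
  then show ?thesis
    unfolding ring_of_type_algebra_def using add.right_inverse
    by unfold_locales (auto simp: algebra_simps Units_def)
qed

lemma ideal_Aq: "ideal (Aq_ideal q kp km) ring_of_type_algebra"
  unfolding Aq_ideal_def
  by (rule ring.genideal_ideal[OF ring_of_type_algebra_ring]) (simp add: ring_of_type_algebra_def)

lemma Aq_simps:
  "carrier (Aq q kp km) = range (Aq_class q kp km)"
  "Aq_class q kp km x \<otimes>\<^bsub>Aq q kp km\<^esub> Aq_class q kp km y = Aq_class q kp km (x * y)"
  "Aq_class q kp km x \<oplus>\<^bsub>Aq q kp km\<^esub> Aq_class q kp km y = Aq_class q kp km (x + y)"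
  "\<one>\<^bsub>Aq q kp km\<^esub> = Aq_class q kp km 1"
  "c \<odot>\<^bsub>Aq q kp km\<^esub> Aq_class q kp km x = Aq_class q kp km (fconst c * x)"
proof -
  let ?R = "ring_of_type_algebra :: Aq_gen free_algebra ring"
  interpret ideal "Aq_ideal q kp km" ?R by (rule ideal_Aq)
  have [simp]: "carrier ?R = UNIV" "x \<otimes>\<^bsub>?R\<^esub> y = x * y" "x \<oplus>\<^bsub>?R\<^esub> y = x + y" "\<one>\<^bsub>?R\<^esub> = 1" for x y
    by (simp_all add: ring_of_type_algebra_def)
  show "carrier (Aq q kp km) = range (Aq_class q kp km)"
    by (auto simp: Aq_def Let_def ring.defs module.defs FactRing_def A_RCOSETS_def' Aq_class_def)
  show "Aq_class q kp km x \<otimes>\<^bsub>Aq q kp km\<^esub> Aq_class q kp km y = Aq_class q kp km (x * y)"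
    using rcoset_mult_add[of x y]
    by (simp add: Aq_def Let_def ring.defs module.defs FactRing_def Aq_class_def)
  show "Aq_class q kp km x \<oplus>\<^bsub>Aq q kp km\<^esub> Aq_class q kp km y = Aq_class q kp km (x + y)"
    using a_rcos_sum[of x y]
    by (simp add: Aq_def Let_def ring.defs module.defs FactRing_def Aq_class_def)
  show "\<one>\<^bsub>Aq q kp km\<^esub> = Aq_class q kp km 1"
    by (simp add: Aq_def Let_def ring.defs module.defs FactRing_def Aq_class_def)
  show "c \<odot>\<^bsub>Aq q kp km\<^esub> Aq_class q kp km x = Aq_class q kp km (fconst c * x)"
    using rcoset_mult_add[of "fconst c" x]
    by (simp add: Aq_def Let_def ring.defs module.defs FactRing_def Aq_class_def)
qed

text \<open>The homomorphism from the free algebra to \<open>\<complex>\<close> that extends \<open>\<phi>\<close>.\<close>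

definition fev :: "('g \<Rightarrow> complex) \<Rightarrow> 'g free_algebra \<Rightarrow> complex" where
 "fev \<phi> x = (\<Sum>w\<in>Poly_Mapping.keys x. Poly_Mapping.lookup x w * prod_list (map \<phi> (letters w)))"

lemma fev_sup: "finite S \<Longrightarrow> Poly_Mapping.keys x \<subseteq> S \<Longrightarrow>
  fev \<phi> x = (\<Sum>w\<in>S. Poly_Mapping.lookup x w * prod_list (map \<phi> (letters w)))"
  unfolding fev_def by (rule sum.mono_neutral_left) (auto simp: in_keys_iff)

lemma fev_add: "fev \<phi> (x + y) = fev \<phi> x + fev \<phi> y"
proof -
  let ?S = "Poly_Mapping.keys x \<union> Poly_Mapping.keys y"
  have "Poly_Mapping.keys (x+y) \<subseteq> ?S" by (rule Poly_Mapping.keys_add)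
  then show ?thesis
    by (simp add: fev_sup[of ?S] lookup_add algebra_simps sum.distrib)
qed

lemma fev_single: "fev \<phi> (Poly_Mapping.single w c) = c * prod_list (map \<phi> (letters w))"
  by (simp add: fev_sup[of "{w}"])

lemma fev_0 [simp]: "fev \<phi> 0 = 0" by (simp add: fev_def)

lemma free_expand: "x = (\<Sum>w\<in>Poly_Mapping.keys x. Poly_Mapping.single w (Poly_Mapping.lookup x w))"
  by (rule poly_mapping_eqI) (simp add: lookup_sum lookup_single when_def in_keys_iff)

lemma fev_sum: "fev \<phi> (sum f S) = (\<Sum>s\<in>S. fev \<phi> (f s))"
  by (induction S rule: infinite_finite_induct) (auto simp: fev_add)

lemma fev_mult: "fev \<phi> (x * y) = fev \<phi> x * fev \<phi> y"
proof -
  have "x * y = (\<Sum>v\<in>Poly_Mapping.keys x. \<Sum>w\<in>Poly_Mapping.keys y.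
     Poly_Mapping.single v (Poly_Mapping.lookup x v) * Poly_Mapping.single w (Poly_Mapping.lookup y w))"
    by (subst (1) free_expand[of x], subst (1) free_expand[of y]) (simp add: sum_product)
  then have "fev \<phi> (x * y) = (\<Sum>v\<in>Poly_Mapping.keys x. \<Sum>w\<in>Poly_Mapping.keys y.
     (Poly_Mapping.lookup x v * prod_list (map \<phi> (letters v))) * (Poly_Mapping.lookup y w * prod_list (map \<phi> (letters w))))"
    by (simp add: fev_sum mult_single fev_single plus_word_def mult_ac)
  then show ?thesis by (simp add: sum_product fev_def)
qed

lemma fev_diff: "fev \<phi> (x - y) = fev \<phi> x - fev \<phi> y"
  using fev_add[of \<phi> "x - y" y] by simp

lemma fev_gen: "fev \<phi> (fgen x) = \<phi> x" "fev \<phi> (fconst c) = c" "fev \<phi> 1 = 1"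
  by (simp_all add: fgen_def fconst_def fev_single zero_word_def flip: single_one)

fun eps_gen :: "(nat \<Rightarrow> complex) \<Rightarrow> complex \<Rightarrow> complex \<Rightarrow> Aq_gen \<Rightarrow> complex" where
  "eps_gen g ep em (gG k) = g (k+1)"
| "eps_gen g ep em (gGt k) = g (k+1)"
| "eps_gen g ep em (gWp k) = eps_W g ep em k"
| "eps_gen g ep em (gWn k) = eps_W g em ep k"

lemma eps_W_0: "g 0 \<noteq> 0 \<Longrightarrow> eps_W g ep em 0 = em"
  by (simp add: eps_W_def)

lemma eps_W_Suc:
  "eps_W g ep em (Suc k) = eps_W g em ep k + inverse (g 0) * em * g (Suc k)"
proof -
  have "(\<Sum>m=0..Suc k. (of_nat (m mod 2) * ep + of_nat ((m + 1) mod 2) * em) * g (Suc k - m)) =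
      em * g (Suc k) +
      (\<Sum>m=0..k. (of_nat (Suc m mod 2) * ep + of_nat (Suc (Suc m) mod 2) * em) * g (k - m))"
    by (subst sum.atLeast0_atMost_Suc_shift) simp
  also have "(\<Sum>m=0..k. (of_nat (Suc m mod 2) * ep + of_nat (Suc (Suc m) mod 2) * em) * g (k - m)) =
      (\<Sum>m=0..k. (of_nat (m mod 2) * em + of_nat ((m + 1) mod 2) * ep) * g (k - m))"
    by (intro sum.cong refl arg_cong2[where f = "(*)"]) (simp_all add: mod_Suc)
  finally show ?thesis by (simp add: eps_W_def algebra_simps)
qed

theorem eps_exists:
  assumes "q \<noteq> 0" and "\<And>n. n > 0 \<Longrightarrow> q ^ n \<noteq> 1" and "kp \<noteq> 0" and "km \<noteq> 0"
    and g0: "g 0 = rho q kp km / (q - inverse q)"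
  shows "\<exists>eps. is_eps q kp km ep em g eps"
proof -
  let ?R = "ring_of_type_algebra :: Aq_gen free_algebra ring"
  let ?f = "fev (eps_gen g ep em)"
  have "q\<^sup>2 \<noteq> 1"
    using assms(2)[of 2] by simp
  moreover have "q\<^sup>2 \<noteq> - 1"
  proof
    assume "q\<^sup>2 = - 1"
    then have "q ^ 4 = 1"
      using power_mult[of q 2 2] by simp
    then show False
      using assms(2)[of 4] by simp
  qed
  moreover have "q * (q - inverse q) = q\<^sup>2 - 1" "q * (q + inverse q) = q\<^sup>2 + 1"
    using \<open>q \<noteq> 0\<close> by (simp_all add: algebra_simps power2_eq_square)
  ultimately have ne: "q - inverse q \<noteq> 0" "q + inverse q \<noteq> 0"
    by (auto simp: eq_neg_iff_add_eq_0)
  have rho: "rho q kp km \<noteq> 0" using assms ne by (simp add: rho_def)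
  have g0n: "g 0 \<noteq> 0" using g0 rho ne by simp
  have key: "rho q kp km * inverse (g 0) = q - inverse q" using g0 rho ne by simp
  have eps_W_Suc': "rho q kp km * eps_W g a b (Suc k)
      = rho q kp km * eps_W g b a k + (q - inverse q) * (b * g (Suc k))" for a b k
    by (simp add: eps_W_Suc ring_distribs flip: key)
  have rel: "?f a = ?f b" if "Aq_rel q kp km a b" for a b
    using that
    by cases (simp_all add: comm_def qcomm_def fev_diff fev_add fev_mult fev_gen eps_W_0 g0n
        right_diff_distrib eps_W_Suc', simp_all add: algebra_simps)
  have ker: "?f x = 0" if "x \<in> Aq_ideal q kp km" for x
  proof -
    have "ideal {x. ?f x = 0} ?R"
    proof (rule idealI[OF ring_of_type_algebra_ring])
      show "subgroup {x. ?f x = 0} (add_monoid ?R)"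
      proof (rule group.subgroupI)
        show "group (add_monoid ?R)"
          using ring_of_type_algebra_ring abelian_group.a_group ring.is_abelian_group by blast
        show "inv\<^bsub>add_monoid ?R\<^esub> a \<in> {x. ?f x = 0}" if a: "a \<in> {x. ?f x = 0}" for a
        proof -
          have "inv\<^bsub>add_monoid ?R\<^esub> a = - a"
            by (rule group.inv_equality[OF abelian_group.a_group[OF ring.is_abelian_group[OF
                  ring_of_type_algebra_ring]]])
              (simp_all add: ring_of_type_algebra_def)
          then show ?thesis using a fev_diff[of "eps_gen g ep em" 0 a] by simp
        qed
      qed (auto simp: ring_of_type_algebra_def fev_add intro: exI[of _ 0])
    qed (auto simp: ring_of_type_algebra_def fev_mult)
    moreover have "{a - b | a b. Aq_rel q kp km a b} \<subseteq> {x. ?f x = 0}"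
      using rel by (auto simp: fev_diff)
    ultimately have "Aq_ideal q kp km \<subseteq> {x. ?f x = 0}"
      unfolding Aq_ideal_def by (rule ring.genideal_minimal[OF ring_of_type_algebra_ring])
    with that show ?thesis by blast
  qed
  have mem: "x \<in> Aq_class q kp km x" for x
  proof -
    interpret ideal "Aq_ideal q kp km" ?R by (rule ideal_Aq)
    show ?thesis unfolding Aq_class_def by (rule a_rcos_self) (simp add: ring_of_type_algebra_def)
  qed
  have const: "?f y = ?f x" if "y \<in> Aq_class q kp km x" for x y
    using that ker unfolding Aq_class_def a_r_coset_def r_coset_def
    by (auto simp: ring_of_type_algebra_def fev_add)
  define eps where "eps S = ?f (SOME y. y \<in> S)" for S
  have eps: "eps (Aq_class q kp km x) = ?f x" for x
    unfolding eps_def by (rule const, rule someI[of "\<lambda>y. y \<in> Aq_class q kp km x", OF mem])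
  have "is_eps q kp km ep em g eps"
    unfolding is_eps_def
    by (auto simp: ring_hom_def Aq_simps eps fev_gen fev_mult fev_add ring_of_type_algebra_def)
  then show ?thesis by blast
qed

end

theory Submission
  imports Defs
begin

text \<open>
  Write \<open>z = U\<^sup>-\<^sup>1\<close> and \<open>G = \<Sum>\<^sub>k g\<^sub>k z\<^sup>k\<close>, and let \<open>P\<close>, \<open>M\<close> be the images under \<open>\<epsilon>\<close> of
  \<open>W\<^sub>+(u)\<close> and \<open>W\<^sub>-(u)\<close>. The images of \<open>G\<^sub>+(u)\<close> and \<open>G\<^sub>-(u)\<close> are both \<open>G - g\<^sub>0\<close>, and the
  constant term of an off-diagonal entry of the matrix is exactly what turns this into a multiple
  of \<open>G\<close>. The recursion
  \<open>eps_W g ep em (k + 1) = eps_W g em ep k + (em / g\<^sub>0) g\<^sub>k\<^sub>+\<^sub>1\<close> says that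
  \<open>U P = M + (ep / g\<^sub>0) G\<close> and \<open>U M = P + (em / g\<^sub>0) G\<close>. This linear system determines \<open>P\<close> and \<open>M\<close>
  because \<open>U\<^sup>2 \<noteq> 1\<close>. In the diagonal entry \<open>uqP - u\<^sup>-\<^sup>1q\<^sup>-\<^sup>1M\<close> the common denominator is, up to a
  constant, \<open>(q + q\<^sup>-\<^sup>1)\<^sup>2 (U\<^sup>2 - 1) = (u\<^sup>2 - u\<^sup>-\<^sup>2) (q\<^sup>2u\<^sup>2 - q\<^sup>-\<^sup>2u\<^sup>-\<^sup>2)\<close>, and its second factor
  divides the numerator (\<open>generating_function_identity\<close>). The other diagonal entry is
  the same statement with \<open>ep\<close> and \<open>em\<close> exchanged.

  Two points make this rigorous for Laurent series in \<open>u\<^sup>-\<^sup>1\<close>. As \<open>z\<close> is a power series \<open>t\<close> in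
  \<open>u\<^sup>-\<^sup>1\<close> without constant term (\<open>UU_inverse\<close>), each series in \<open>z\<close> is the composition of a formal
  power series with \<open>t\<close>, and the adically convergent sum in the statement is one too
  (\<open>fps_to_fls_compose_sums\<close>). And \<open>\<epsilon>\<close> is a homomorphism, so it commutes with the coefficientwise finite sums
  that define the operations on series over the algebra (the lemmas on \<open>eps_image\<close>).
\<close>

(* From here on, $ denotes coefficients of power series only. *)
unbundle no vec_syntax

section \<open>Composition of power series as a convergent sum\<close>

lemma isometry_fps_to_fls: "dist (fps_to_fls f) (fps_to_fls h) = dist f (h :: 'a::group_add fps)"
  by (simp add: dist_fls_def dist_fps_def fls_subdegree_fls_to_fps flip: fps_to_fls_minus)

lemma fps_to_fls_sum: "fps_to_fls (sum f A) = (\<Sum>i\<in>A. fps_to_fls (f i))"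
  by (induction A rule: infinite_finite_induct) simp_all

text \<open>The summation bound in the definition of composition may be raised freely.\<close>

lemma fps_compose_nth_ge:
  fixes a b :: "'a::idom fps"
  assumes "b $ 0 = 0" "n \<le> N"
  shows "(a oo b) $ n = (\<Sum>i=0..N. a $ i * (b ^ i) $ n)"
  unfolding fps_compose_nth
  using assms by (intro sum.mono_neutral_left) (auto simp: startsby_zero_power_prefix)

lemma fps_compose_sums:
  fixes a b :: "'a::idom fps"
  assumes "b $ 0 = 0"
  shows "(\<lambda>k. b ^ k * fps_const (a $ k)) sums (a oo b)"
  unfolding sums_def
proof (rule tendsto_fpsI)
  fix n
  have "(\<Sum>k<N. b ^ k * fps_const (a $ k)) $ n = (a oo b) $ n" if "N > n" for N
  proof -
    from that obtain M where M: "N = Suc M" "n \<le> M"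
      by (cases N) auto
    show ?thesis
      unfolding fps_compose_nth_ge[OF assms M(2)]
      by (simp add: M(1) fps_sum_nth lessThan_Suc_atMost atMost_atLeast0 mult.commute)
  qed
  then show "\<forall>\<^sub>F N in sequentially. (\<Sum>k<N. b ^ k * fps_const (a $ k)) $ n = (a oo b) $ n"
    using eventually_gt_at_top by (rule eventually_mono[rotated])
qed

lemma fps_to_fls_compose_sums:
  fixes a b :: "'a::idom fps"
  assumes "b $ 0 = 0"
  shows "(\<lambda>k. fps_to_fls b ^ k * fls_const (a $ k)) sums fps_to_fls (a oo b)"
proof -
  have "(\<lambda>N. fps_to_fls (\<Sum>k<N. b ^ k * fps_const (a $ k))) \<longlonglongrightarrow> fps_to_fls (a oo b)"
    using fps_compose_sums[OF assms, of a]
    unfolding sums_def tendsto_iff by (simp add: isometry_fps_to_fls)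
  then show ?thesis
    by (simp add: sums_def fps_to_fls_sum fls_times_fps_to_fls fps_to_fls_power)
qed

section \<open>Applying a character to series over the algebra\<close>

lemma Aq_zero: "\<zero>\<^bsub>Aq q kp km\<^esub> = Aq_class q kp km 0"
proof -
  interpret ideal "Aq_ideal q kp km" "ring_of_type_algebra :: Aq_gen free_algebra ring"
    by (rule ideal_Aq)
  have "0 \<in> Aq_ideal q kp km"
    using additive_subgroup.zero_closed[OF is_additive_subgroup] by (simp add: ring_of_type_algebra_def)
  then show ?thesis
    using a_rcos_const[of 0]
    by (simp add: Aq_def Let_def ring.defs module.defs FactRing_def Aq_class_def)
qed

text \<open>
  The record has an additional field for the scalar multiplication, so that this is not literally the
  statement that the quotient by the ideal is a ring.
\<close>

lemma Aq_ring: "ring (Aq q kp km)"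
proof -
  note simps = Aq_simps Aq_zero
  have "abelian_group (Aq q kp km)"
  proof (rule abelian_groupI)
    fix x assume "x \<in> carrier (Aq q kp km)"
    then obtain a where "x = Aq_class q kp km a"
      by (auto simp: simps)
    then show "\<exists>y\<in>carrier (Aq q kp km). y \<oplus>\<^bsub>Aq q kp km\<^esub> x = \<zero>\<^bsub>Aq q kp km\<^esub>"
      by (intro bexI[of _ "Aq_class q kp km (- a)"]) (simp_all add: simps)
  qed (auto simp: simps add_ac)
  then show ?thesis
    by (rule ringI) (auto intro!: monoidI simp: simps algebra_simps)
qed

lemma finsum_ring_of_type_algebra:
  "finsum (ring_of_type_algebra :: 'a::comm_ring_1 ring) f A = sum f A"
proof -
  interpret R: ring "ring_of_type_algebra :: 'a ring"
    by (rule ring_of_type_algebra_ring)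
  have [simp]: "\<zero>\<^bsub>ring_of_type_algebra\<^esub> = (0::'a)" "carrier ring_of_type_algebra = (UNIV :: 'a set)"
      "x \<oplus>\<^bsub>ring_of_type_algebra\<^esub> y = x + y" for x y :: 'a
    by (simp_all add: ring_of_type_algebra_def)
  show ?thesis
    by (induction A rule: infinite_finite_induct) simp_all
qed

text \<open>
  A one-dimensional representation of the algebra, as a function on the classes of the quotient.
  No values on the generators are prescribed.
\<close>

locale Aq_character =
  fixes q kp km :: complex and eps :: "Aq_gen free_algebra set \<Rightarrow> complex"
  assumes hom: "eps \<in> ring_hom (Aq q kp km) ring_of_type_algebra"
    and scalar: "x \<in> carrier (Aq q kp km) \<Longrightarrow> eps (c \<odot>\<^bsub>Aq q kp km\<^esub> x) = c * eps x"
begin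

abbreviation A where "A \<equiv> Aq q kp km"

sublocale A: ring A by (rule Aq_ring)

sublocale ring_hom_ring A "ring_of_type_algebra :: complex ring" eps
  by (rule ring_hom_ringI2[OF Aq_ring ring_of_type_algebra_ring hom])

declare hom_add [simp del] hom_zero [simp del] hom_one [simp del]

lemma smult_closed: "x \<in> carrier A \<Longrightarrow> c \<odot>\<^bsub>A\<^esub> x \<in> carrier A"
  by (auto simp: Aq_simps)

lemma eps_add: "x \<in> carrier A \<Longrightarrow> y \<in> carrier A \<Longrightarrow> eps (x \<oplus>\<^bsub>A\<^esub> y) = eps x + eps y"
  using hom_add by (simp add: ring_of_type_algebra_def)

lemma eps_one: "eps \<one>\<^bsub>A\<^esub> = 1"
  using hom_one by (simp add: ring_of_type_algebra_def)

lemma eps_zero: "eps \<zero>\<^bsub>A\<^esub> = 0"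
  using hom_zero by (simp add: ring_of_type_algebra_def)

lemma eps_diff:
  assumes "x \<in> carrier A" "y \<in> carrier A"
  shows "eps (x \<ominus>\<^bsub>A\<^esub> y) = eps x - eps y"
proof -
  have "eps x = eps ((x \<ominus>\<^bsub>A\<^esub> y) \<oplus>\<^bsub>A\<^esub> y)"
    using assms by (simp add: a_minus_def A.a_assoc A.l_neg)
  then show ?thesis
    using assms by (simp add: eps_add)
qed

lemma eps_finsum: "f \<in> I \<rightarrow> carrier A \<Longrightarrow> eps (finsum A f I) = (\<Sum>i\<in>I. eps (f i))"
  by (simp add: finsum_ring_of_type_algebra o_def)

text \<open>
  \<open>s\<close> is a Laurent series over the algebra, meaning that its coefficients vanish below some index,
  and applying the representation to its coefficients gives \<open>F\<close>. The vanishing keeps the index set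
  in \<^const>\<open>ser_smult\<close> finite: a sum over an infinite set would be a default value.
\<close>

definition eps_image :: "(int \<Rightarrow> Aq_gen free_algebra set) \<Rightarrow> complex fls \<Rightarrow> bool"
  where "eps_image s F \<longleftrightarrow>
    range s \<subseteq> carrier A \<and> (\<exists>N. \<forall>n<N. s n = \<zero>\<^bsub>A\<^esub>) \<and> eps \<circ> s = fls_nth F"

lemma eps_image_const: "eps_image (ser_const A f) f"
proof -
  have "ser_const A f n = \<zero>\<^bsub>A\<^esub>" if "n < fls_subdegree f" for n
    using that by (simp add: ser_const_def Aq_simps Aq_zero fconst_def)
  moreover have "ser_const A f n \<in> carrier A" "eps (ser_const A f n) = fls_nth f n" for n
    by (simp_all add: ser_const_def smult_closed scalar eps_one)
  ultimately show ?thesis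
    unfolding eps_image_def by (auto simp: fun_eq_iff)
qed

lemma eps_image_add:
  assumes "eps_image s F" "eps_image t G"
  shows "eps_image (ser_add A s t) (F + G)"
proof -
  obtain M N where MN: "\<forall>n<M. s n = \<zero>\<^bsub>A\<^esub>" "\<forall>n<N. t n = \<zero>\<^bsub>A\<^esub>"
    using assms by (auto simp: eps_image_def)
  have "s n \<in> carrier A" "t n \<in> carrier A" "eps (s n) = fls_nth F n" "eps (t n) = fls_nth G n" for n
    using assms by (auto simp: eps_image_def fun_eq_iff)
  then show ?thesis
    unfolding eps_image_def using MN
    by (auto simp: ser_add_def eps_add intro!: exI[of _ "min M N"])
qed

lemma eps_image_diff:
  assumes "eps_image s F" "eps_image t G"
  shows "eps_image (ser_diff A s t) (F - G)"
proof -
  obtain M N where MN: "\<forall>n<M. s n = \<zero>\<^bsub>A\<^esub>" "\<forall>n<N. t n = \<zero>\<^bsub>A\<^esub>"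
    using assms by (auto simp: eps_image_def)
  have "s n \<in> carrier A" "t n \<in> carrier A" "eps (s n) = fls_nth F n" "eps (t n) = fls_nth G n" for n
    using assms by (auto simp: eps_image_def fun_eq_iff)
  then show ?thesis
    unfolding eps_image_def using MN
    by (auto simp: ser_diff_def eps_diff A.minus_closed A.r_right_minus_eq intro!: exI[of _ "min M N"])
qed

lemma eps_image_smult:
  assumes "eps_image s F"
  shows "eps_image (ser_smult A f s) (f * F)"
proof -
  obtain N where N: "\<And>n. n < N \<Longrightarrow> s n = \<zero>\<^bsub>A\<^esub>"
    using assms by (auto simp: eps_image_def)
  have s: "s n \<in> carrier A" and eps_s: "eps (s n) = fls_nth F n" for n
    using assms by (auto simp: eps_image_def fun_eq_iff)
  define I where "I n = {i. fls_nth f i \<noteq> 0 \<and> s (n - i) \<noteq> \<zero>\<^bsub>A\<^esub>}" for n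
  have I: "I n \<subseteq> {fls_subdegree f..n - N}" for n
    unfolding I_def using N by (force simp: not_less[symmetric])
  have "ser_smult A f s n = \<zero>\<^bsub>A\<^esub>" if "n < fls_subdegree f + N" for n
  proof -
    have "I n = {}"
      using I[of n] that by auto
    then show ?thesis
      by (simp add: ser_smult_def flip: I_def)
  qed
  moreover have "ser_smult A f s n \<in> carrier A" for n
    unfolding ser_smult_def by (intro A.finsum_closed) (simp add: s smult_closed)
  moreover have "eps (ser_smult A f s n) = fls_nth (f * F) n" for n
  proof -
    \<comment> \<open>The order of \<open>F\<close> and the bound \<open>N\<close> need not agree, so both index ranges are compared inside
      a common one.\<close>
    define J where "J = {fls_subdegree f..max (n - N) (n - fls_subdegree F)}"
    have "eps (ser_smult A f s n) = (\<Sum>i\<in>I n. fls_nth f i * fls_nth F (n - i))"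
      unfolding ser_smult_def I_def[symmetric]
      by (subst eps_finsum) (simp_all add: s smult_closed scalar eps_s)
    also have "\<dots> = (\<Sum>i\<in>J. fls_nth f i * fls_nth F (n - i))"
    proof (rule sum.mono_neutral_left)
      show "\<forall>i\<in>J - I n. fls_nth f i * fls_nth F (n - i) = 0"
        by (auto simp: I_def simp flip: eps_s simp: eps_zero)
    qed (use I[of n] in \<open>auto simp: J_def subset_iff le_max_iff_disj\<close>)
    also have "\<dots> = (\<Sum>i=fls_subdegree f..n - fls_subdegree F. fls_nth f i * fls_nth F (n - i))"
      by (rule sum.mono_neutral_right) (auto simp: J_def)
    finally show ?thesis
      by (simp add: fls_times_nth(2))
  qed
  ultimately show ?thesis
    unfolding eps_image_def by (auto simp: fun_eq_iff intro!: exI[of _ "fls_subdegree f + N"])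
qed

text \<open>
  The exponent \<open>k + 1\<close> accounts for the factor in front: the series is \<open>z \<Sum>\<^sub>k a\<^sub>k z\<^sup>k\<close> at \<open>z = t\<close>.
\<close>

lemma eps_image_sum:
  assumes "t $ 0 = 0" and a: "\<And>k. a k \<in> carrier A"
  shows "eps_image (ser_sum A (\<lambda>k. fps_to_fls t ^ (k + 1)) a)
    (fps_to_fls t * fps_to_fls (Abs_fps (\<lambda>k. eps (a k)) oo t))"
proof -
  define c where "c = Abs_fps (\<lambda>k. eps (a k))"
  have tc: "fps_to_fls t * fps_to_fls (c oo t) = fps_to_fls ((fps_X * c) oo t)"
    using assms by (simp add: fps_compose_mult_distrib fls_times_fps_to_fls)
  have "ser_sum A (\<lambda>k. fps_to_fls t ^ (k + 1)) a n = \<zero>\<^bsub>A\<^esub>" if "n < 0" for n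
    using that by (simp add: ser_sum_def flip: fps_to_fls_power power_Suc)
  moreover have "ser_sum A (\<lambda>k. fps_to_fls t ^ (k + 1)) a n \<in> carrier A" for n
    unfolding ser_sum_def by (intro A.finsum_closed) (simp add: a smult_closed)
  moreover have "eps (ser_sum A (\<lambda>k. fps_to_fls t ^ (k + 1)) a n) = fls_nth (fps_to_fls ((fps_X * c) oo t)) n" for n
  proof (cases "n < 0")
    case True
    then show ?thesis
      using calculation(1)[OF True] by (simp add: eps_zero del: power_Suc)
  next
    case False
    then obtain m where n: "n = int m"
      by (metis nonneg_int_cases not_less)
    have "eps (ser_sum A (\<lambda>k. fps_to_fls t ^ (k + 1)) a n) =
        (\<Sum>k | fls_nth (fps_to_fls t ^ (k + 1)) n \<noteq> 0. fls_nth (fps_to_fls t ^ (k + 1)) n * eps (a k))"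
      unfolding ser_sum_def
      by (subst eps_finsum) (simp_all del: power_Suc add: a smult_closed scalar)
    also have "\<dots> = (\<Sum>k | (t ^ Suc k) $ m \<noteq> 0. (t ^ Suc k) $ m * eps (a k))"
      by (simp add: n del: power_Suc flip: fps_to_fls_power)
    also have "\<dots> = (\<Sum>k=0..m. (t ^ Suc k) $ m * eps (a k))"
    proof (rule sum.mono_neutral_left)
      have "(t ^ Suc k) $ m = 0" if "m < k" for k
        using startsby_zero_power_prefix[OF assms(1), of "Suc k"] that by simp
      then show "{k. (t ^ Suc k) $ m \<noteq> 0} \<subseteq> {0..m}"
        by (force simp del: power_Suc simp: not_less[symmetric])
    qed (auto simp del: power_Suc)
    also have "\<dots> = ((fps_X * c) oo t) $ m"
      unfolding fps_compose_nth_ge[OF assms(1) le_SucI[OF order_refl]]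
      by (subst sum.atLeast0_atMost_Suc_shift) (simp add: c_def mult.commute)
    finally show ?thesis
      by (simp add: n)
  qed
  ultimately show ?thesis
    unfolding eps_image_def tc[unfolded c_def] c_def by (auto simp: fun_eq_iff intro!: exI[of _ 0])
qed

end

section \<open>The relation between the generating functions\<close>

text \<open>
  The ordinary generating function of the values of the representation at \<open>W\<^bsub>k+1\<^esub>\<close>; exchanging
  \<open>ep\<close> and \<open>em\<close> gives the values at \<open>W\<^bsub>-k\<^esub>\<close>.
\<close>

definition eps_W_fps :: "(nat \<Rightarrow> complex) \<Rightarrow> complex \<Rightarrow> complex \<Rightarrow> complex fps"
  where "eps_W_fps g ep em = Abs_fps (eps_W g ep em)"

lemma eps_W_fps_rec:
  assumes "g 0 \<noteq> 0"
  shows "eps_W_fps g ep em = fps_X * eps_W_fps g em ep + fps_const (em / g 0) * Abs_fps g"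
proof (rule fps_ext)
  fix n
  show "eps_W_fps g ep em $ n = (fps_X * eps_W_fps g em ep + fps_const (em / g 0) * Abs_fps g) $ n"
    using assms by (cases n) (simp_all add: eps_W_fps_def eps_W_0 eps_W_Suc divide_inverse)
qed

text \<open>
  Solving the two equations for \<open>P\<close> and \<open>M\<close> gives \<open>(U\<^sup>2 - 1) P = (f + e U) G\<close> and
  \<open>(U\<^sup>2 - 1) M = (e + f U) G\<close>; both sides of the conclusion agree after multiplication by
  \<open>D = q\<^sup>2u\<^sup>2 - q\<^sup>-\<^sup>2u\<^sup>-\<^sup>2\<close>, a factor of \<open>(q + q\<^sup>-\<^sup>1)\<^sup>2 (U\<^sup>2 - 1)\<close>.
\<close>

lemma generating_function_identity:
  fixes u q e f U P M G :: "'a::field"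
  assumes "u \<noteq> 0" "q \<noteq> 0" "q + inverse q \<noteq> 0"
    and U: "U = (q * u\<^sup>2 + inverse q * (inverse u)\<^sup>2) / (q + inverse q)" and "U\<^sup>2 \<noteq> 1"
    and P: "U * P = M + e * G" and M: "U * M = P + f * G"
  shows "(u\<^sup>2 - inverse (u\<^sup>2)) * (u * q * P - inverse u * inverse q * M) =
    (q + inverse q) * G * (u * e + inverse u * f)"
proof -
  define r where "r = q + inverse q"
  define v where "v = inverse u"
  define w where "w = inverse q"
  define D where "D = q\<^sup>2 * u\<^sup>2 - w\<^sup>2 * v\<^sup>2"
  have inv: "u * v = 1" "q * w = 1" "r = q + w" "inverse (u\<^sup>2) = v\<^sup>2"
    using assms by (simp_all add: v_def w_def r_def power_inverse)
  have "r \<noteq> 0"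
    using assms by (simp add: r_def)
  have rU: "r * U = q * u\<^sup>2 + w * v\<^sup>2"
    using U \<open>r \<noteq> 0\<close> by (simp add: r_def v_def w_def)
  have "r\<^sup>2 * (U\<^sup>2 - 1) = (q * u\<^sup>2 + w * v\<^sup>2)\<^sup>2 - (q + w)\<^sup>2"
    unfolding rU[symmetric] inv(3)[symmetric] by (simp add: power_mult_distrib right_diff_distrib)
  also have "\<dots> = (u\<^sup>2 - v\<^sup>2) * D + (q + w)\<^sup>2 * ((u * v)\<^sup>2 - 1)"
    unfolding D_def by (simp add: algebra_simps power2_eq_square)
  also have "\<dots> = (u\<^sup>2 - v\<^sup>2) * D"
    by (simp add: inv)
  finally have fac: "r\<^sup>2 * (U\<^sup>2 - 1) = (u\<^sup>2 - v\<^sup>2) * D" .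
  then have "D \<noteq> 0"
    using \<open>r \<noteq> 0\<close> \<open>U\<^sup>2 \<noteq> 1\<close> by auto
  have P2: "(U\<^sup>2 - 1) * P = (f + e * U) * G" and M2: "(U\<^sup>2 - 1) * M = (e + f * U) * G"
  proof -
    have "(U\<^sup>2 - 1) * x = U * (U * x) - x" for x
      by (simp add: power2_eq_square left_diff_distrib mult.assoc)
    note eq = this[of P, unfolded P distrib_left M] this[of M, unfolded M distrib_left P]
    show "(U\<^sup>2 - 1) * P = (f + e * U) * G" "(U\<^sup>2 - 1) * M = (e + f * U) * G"
      unfolding eq by (simp_all add: algebra_simps)
  qed
  have "u * q * (r * U) - v * w * r = u * D + v * w * (q + w) * (u * v - 1)"
    unfolding D_def rU unfolding inv(3) by (simp add: algebra_simps power2_eq_square)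
  then have e: "u * q * (r * U) - v * w * r = u * D"
    by (simp add: inv)
  have "u * q * r - v * w * (r * U) = v * D + q * u * (q + w) * (1 - u * v)"
    unfolding D_def rU unfolding inv(3) by (simp add: algebra_simps power2_eq_square)
  then have f: "u * q * r - v * w * (r * U) = v * D"
    by (simp add: inv)
  have "D * ((u\<^sup>2 - v\<^sup>2) * (u * q * P - v * w * M)) =
      (r\<^sup>2 * (U\<^sup>2 - 1)) * (u * q * P - v * w * M)"
    unfolding fac by simp
  also have "\<dots> = r\<^sup>2 * (u * q * ((U\<^sup>2 - 1) * P) - v * w * ((U\<^sup>2 - 1) * M))"
    by (simp add: algebra_simps)
  also have "\<dots> = r * G * (e * (u * q * (r * U) - v * w * r) + f * (u * q * r - v * w * (r * U)))"
    unfolding P2 M2 by (simp add: algebra_simps power2_eq_square)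
  also have "\<dots> = D * (r * G * (u * e + v * f))"
    unfolding e f by (simp add: algebra_simps)
  finally show ?thesis
    using \<open>D \<noteq> 0\<close> by (simp add: r_def v_def w_def power_inverse)
qed

section \<open>The inverse of \<open>U\<close>\<close>

text \<open>
  \<open>U = u\<^sup>2 (q + q\<^sup>-\<^sup>1u\<^sup>-\<^sup>4) / (q + q\<^sup>-\<^sup>1)\<close>, where the factor after \<open>u\<^sup>2\<close> is an invertible power series
  in \<open>u\<^sup>-\<^sup>1\<close>. That \<open>U\<^sup>-\<^sup>1\<close> has no constant term also excludes \<open>U\<^sup>2 = 1\<close>.
\<close>

lemma UU_inverse:
  assumes "q \<noteq> 0" "q + inverse q \<noteq> 0"
  obtains t where "t $ 0 = 0" "inverse (UU q) = fps_to_fls t" "UU q \<noteq> 0" "(UU q)\<^sup>2 \<noteq> 1"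
proof -
  define d where "d = fps_const (1 / (q + inverse q)) * (fps_const q + fps_const (inverse q) * fps_X ^ 4)"
  define t where "t = fps_X\<^sup>2 * inverse d"
  have d0: "d $ 0 \<noteq> 0"
    using assms by (simp add: d_def)
  have "fps_to_fls d = fls_const (1 / (q + inverse q)) * (fls_const q + fls_const (inverse q) * fls_X ^ 4)"
    by (simp add: d_def fls_times_fps_to_fls fps_to_fls_power)
  moreover have "(inverse x)\<^sup>2 * (c * (a + b * x ^ 4)) = (a * (inverse x)\<^sup>2 + b * (inverse (inverse x))\<^sup>2) * c"
    if "x \<noteq> 0" for x a b c :: "complex fls"
    using that by (simp add: field_simps power4_eq_xxxx power2_eq_square)
  note this[of fls_X "fls_const (1 / (q + inverse q))" "fls_const q" "fls_const (inverse q)"]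
  ultimately have "uu\<^sup>2 * fps_to_fls d = UU q"
    unfolding UU_def
    by (simp add: divide_inverse fls_inverse_const flip: fls_inverse_X)
  moreover have "inverse (fps_to_fls d) = fps_to_fls (inverse d)"
    using d0 by (intro fls_inverse_fps_to_fls) (simp add: subdegree_eq_0)
  ultimately have T: "inverse (UU q) = fps_to_fls t"
    by (simp add: t_def fls_times_fps_to_fls fps_to_fls_power flip: \<open>_ = UU q\<close> fls_inverse_X power_inverse)
  have t: "t $ 0 = 0"
    by (simp add: t_def)
  have "t \<noteq> 0"
    using d0 by (auto simp: t_def)
  then have "UU q \<noteq> 0"
    using T by auto
  moreover have "(UU q)\<^sup>2 \<noteq> 1"
  proof
    assume "(UU q)\<^sup>2 = 1"
    then have "fps_to_fls (t\<^sup>2) = fps_to_fls 1"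
      using T[symmetric] by (simp add: fps_to_fls_power power_inverse)
    then have "(t\<^sup>2) $ 0 = 1"
      by (simp only: fps_to_fls_eq_iff) simp
    with t show False
      by (simp add: power2_eq_square)
  qed
  ultimately show thesis
    using that t T by blast
qed

section \<open>The image of the matrix\<close>

lemma map_matrix_mat2: "map_matrix f (mat2 a b c d) = mat2 (f a) (f b) (f c) (f d)"
  by (simp add: map_matrix_def mat2_def vec_eq_iff)

theorem proposition2p9:
  fixes q kp km ep em :: complex
    and g :: "nat \<Rightarrow> complex"
    and eps :: "Aq_gen free_algebra set \<Rightarrow> complex"
  assumes "q \<noteq> 0" and "\<And>n. n > 0 \<Longrightarrow> q ^ n \<noteq> 1"
    and "kp \<noteq> 0" and "km \<noteq> 0"
    and "g 0 = rho q kp km / (q - inverse q)"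
    and "is_eps q kp km ep em g eps"
  shows "map_matrix (\<lambda>s. eps \<circ> s) (calK q kp km) =
           map_matrix fls_nth (map_matrix (\<lambda>f. varsig q kp km g * f) (Kmat q kp km ep em)) \<and>
         varsig q kp km g dvd 1"
proof -
  interpret Aq_character q kp km eps
    using assms(6) by unfold_locales (auto simp: is_eps_def)
  have "q * (q - inverse q) = q ^ 2 - 1"
    using \<open>q \<noteq> 0\<close> by (simp add: right_diff_distrib power2_eq_square)
  \<comment> \<open>The second and the fourth power of \<open>q\<close> are all that matters.\<close>
  moreover have "q * (q + inverse q) * (q\<^sup>2 - 1) = q ^ 4 - 1"
    using \<open>q \<noteq> 0\<close> by (simp add: algebra_simps power2_eq_square power4_eq_xxxx)
  ultimately have ne: "q - inverse q \<noteq> 0" "q + inverse q \<noteq> 0"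
    using assms(2)[of 2] assms(2)[of 4] by auto
  then have rho: "rho q kp km \<noteq> 0"
    using assms by (simp add: rho_def)
  then have g0: "g 0 \<noteq> 0"
    using assms(5) ne by simp
  obtain t where t: "t $ 0 = 0" and T: "inverse (UU q) = fps_to_fls t"
    and U: "UU q \<noteq> 0" "(UU q)\<^sup>2 \<noteq> 1"
    using UU_inverse \<open>q \<noteq> 0\<close> ne(2) by blast
  have cu: "uu\<^sup>2 - inverse (uu\<^sup>2) \<noteq> 0"
  proof
    assume "uu\<^sup>2 - inverse (uu\<^sup>2) = 0"
    then have "fls_subdegree (uu\<^sup>2) = fls_subdegree (inverse (uu\<^sup>2))"
      by simp
    then show False
      by (simp only: fls_inverse_subdegree fls_subdegree_pow) simp
  qed

  define G where "G = fps_to_fls (Abs_fps g oo t)"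
  \<comment> \<open>\<open>W em ep\<close> is the image of \<open>W\<^sub>+(u)\<close> and \<open>W ep em\<close> that of \<open>W\<^sub>-(u)\<close>.\<close>
  define W where "W a b = fps_to_fls t * fps_to_fls (eps_W_fps g a b oo t)" for a b
  have UW: "UU q * W a b = W b a + fls_const (b / g 0) * G" for a b
  proof -
    have "UU q * W a b = fps_to_fls (eps_W_fps g a b oo t)"
      using U(1) by (simp add: W_def flip: T)
    also have "eps_W_fps g a b oo t = t * (eps_W_fps g b a oo t) + fps_const (b / g 0) * (Abs_fps g oo t)"
      using t g0
      by (subst eps_W_fps_rec) (simp_all add: fps_compose_add_distrib fps_compose_mult_distrib)
    finally show ?thesis
      by (simp add: W_def G_def fls_times_fps_to_fls)
  qed
  have G_shift: "fps_to_fls t * fps_to_fls (Abs_fps (\<lambda>k. g (k + 1)) oo t) = G - fls_const (g 0)"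
  proof -
    have "Abs_fps g = fps_X * Abs_fps (\<lambda>k. g (k + 1)) + fps_const (g 0)"
    proof (rule fps_ext)
      fix n
      show "Abs_fps g $ n = (fps_X * Abs_fps (\<lambda>k. g (k + 1)) + fps_const (g 0)) $ n"
        by (cases n) simp_all
    qed
    then have "G = fps_to_fls ((fps_X * Abs_fps (\<lambda>k. g (k + 1)) + fps_const (g 0)) oo t)"
      unfolding G_def by simp
    then show ?thesis
      using t by (simp add: fps_compose_add_distrib fps_compose_mult_distrib fls_times_fps_to_fls)
  qed
  have varsig: "varsig q kp km g = fls_const (cfun (q\<^sup>2)) / (fls_const (rho q kp km) * cfun (uu\<^sup>2)) * G"
    using fps_to_fls_compose_sums[OF t, of "Abs_fps g", THEN sums_unique]
    by (simp add: varsig_def G_def T)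

  have gen: "eps_image (gen_series q kp km x)
      (fps_to_fls t * fps_to_fls (Abs_fps (\<lambda>k. eps (Aq_class q kp km (fgen (x k)))) oo t))" for x
    unfolding gen_series_def T by (rule eps_image_sum[OF t]) (simp add: Aq_simps)
  have series: "eps_image (gen_series q kp km gWn) (W em ep)" "eps_image (gen_series q kp km gWp) (W ep em)"
    "eps_image (gen_series q kp km gG) (G - fls_const (g 0))"
    "eps_image (gen_series q kp km gGt) (G - fls_const (g 0))"
    using gen[of gWn] gen[of gWp] gen[of gG] gen[of gGt] assms(6)
    by (simp_all add: is_eps_def W_def eps_W_fps_def G_shift[simplified])

  define C where "C = uu\<^sup>2 - inverse (uu\<^sup>2)"
  have C: "C \<noteq> 0" "cfun (uu\<^sup>2) = C"
    using cu by (simp_all add: C_def cfun_def)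
  define s where "s = q + inverse q"
  define d where "d = q - inverse q"
  have sd: "s \<noteq> 0" "d \<noteq> 0" "g 0 * d = rho q kp km" "rho q kp km = kp * km * s\<^sup>2" "g 0 = kp * km * s\<^sup>2 / d"
    using ne assms(5) by (simp_all add: s_def d_def rho_def)
  have "cfun (q\<^sup>2) = s * d"
    using \<open>q \<noteq> 0\<close> by (simp add: cfun_def s_def d_def algebra_simps power2_eq_square)
  then have scal: "cfun (q\<^sup>2) / rho q kp km = s / g 0"
    unfolding sd(3)[symmetric] using sd(2) by simp
  have varsig': "C * varsig q kp km g = fls_const (s / g 0) * G"
    unfolding varsig scal[symmetric] C(2)
    using C(1) rho by (simp flip: fls_const_divide_const)
  have const_g0: "fls_const (x / g 0) = fls_const x * fls_const (inverse (g 0))" for x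
    by (simp add: divide_inverse)
  \<comment> \<open>The two diagonal entries are the cases \<open>(ep, em)\<close> and \<open>(em, ep)\<close> of \<open>(a, b)\<close>.\<close>
  have diag: "uu * fls_const q * W b a - inverse uu * fls_const (inverse q) * W a b =
      varsig q kp km g * (uu * fls_const a + inverse uu * fls_const b)" for a b
  proof -
    have "C * (uu * fls_const q * W b a - inverse uu * inverse (fls_const q) * W a b) =
       (fls_const q + inverse (fls_const q)) * G * (uu * fls_const (a / g 0) + inverse uu * fls_const (b / g 0))"
      unfolding C_def using U(2) UW ne(2) \<open>q \<noteq> 0\<close>
      by (intro generating_function_identity[where U = "UU q"])
        (simp_all add: UU_def fls_inverse_const fls_plus_const)
    also have "\<dots> = fls_const (s / g 0) * G * (uu * fls_const a + inverse uu * fls_const b)"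
      unfolding const_g0 fls_inverse_const fls_plus_const s_def
      by (simp only: distrib_left distrib_right mult_ac)
    also have "\<dots> = C * (varsig q kp km g * (uu * fls_const a + inverse uu * fls_const b))"
      by (simp only: varsig'[symmetric] mult.assoc)
    finally show ?thesis
      using C(1) by (simp add: fls_inverse_const)
  qed
  \<comment> \<open>The two off-diagonal entries are the cases \<open>(kp, km)\<close> and \<open>(km, kp)\<close> of \<open>(a, b)\<close>. The constant
    term of the matrix cancels the constant \<open>g 0\<close> subtracted from \<open>G\<close>.\<close>
  have off: "fls_const (1 / (b * (q + inverse q))) * (G - fls_const (g 0)) +
      fls_const (a * (q + inverse q) / (q - inverse q)) =
      varsig q kp km g * (fls_const a * (uu\<^sup>2 - (inverse uu)\<^sup>2) / fls_const (q - inverse q))"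
    if ab: "a * b = kp * km" "b \<noteq> 0" for a b
  proof -
    have a: "a \<noteq> 0"
      using ab \<open>kp \<noteq> 0\<close> \<open>km \<noteq> 0\<close> by auto
    have "1 / (b * s) * g 0 = a * s / d"
      using sd(1,2) a ab(2) unfolding sd(5) ab(1)[symmetric] by (simp add: power2_eq_square)
    then have "fls_const (1 / (b * s)) * (G - fls_const (g 0)) + fls_const (a * s / d) =
        fls_const (1 / (b * s)) * G"
      by (simp add: right_diff_distrib)
    also have "\<dots> = fls_const (s / g 0 * (a / d)) * G"
      using sd(1,2) a ab(2) unfolding sd(5) ab(1)[symmetric] by (simp add: power2_eq_square)
    also have "\<dots> = C * varsig q kp km g * fls_const (a / d)"
      unfolding varsig' by (simp only: fls_const_mult_const[symmetric] mult_ac)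
    also have "\<dots> = varsig q kp km g * (fls_const a * C / fls_const d)"
      by (simp only: fls_const_divide_const[symmetric] times_divide_eq_right times_divide_eq_left mult_ac)
    finally show ?thesis
      by (simp only: C_def s_def d_def power_inverse)
  qed
  have entry: "eps \<circ> x = fls_nth F'" if "eps_image x F" "F = F'" for x F F'
    using that by (simp add: eps_image_def)
  note diag_entry = entry[OF eps_image_diff[OF eps_image_smult eps_image_smult] diag]
  note off_entry = entry[OF eps_image_add[OF eps_image_smult eps_image_const] off]
  have "map_matrix (\<lambda>s. eps \<circ> s) (calK q kp km) =
      map_matrix fls_nth (map_matrix (\<lambda>f. varsig q kp km g * f) (Kmat q kp km ep em))"
    unfolding calK_def Kmat_def Let_def map_matrix_mat2
      diag_entry[OF series(1,2)] diag_entry[OF series(2,1)]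
      off_entry[OF series(3) refl \<open>km \<noteq> 0\<close>]
      off_entry[OF series(4) mult.commute \<open>kp \<noteq> 0\<close>] ..
  moreover have "varsig q kp km g \<noteq> 0"
  proof
    assume "varsig q kp km g = 0"
    then have "fls_const (s / g 0) * G = 0"
      using varsig' by (simp only: mult_zero_right)
    then have "Abs_fps g oo t = 0"
      using sd(1) g0 by (simp add: G_def)
    moreover have "(Abs_fps g oo t) $ 0 = g 0"
      by simp
    ultimately show False
      using g0 by simp
  qed
  ultimately show ?thesis
    by (simp add: dvd_field_iff)
qed

end
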